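(* Consider the problem $\min_{x\in\mathcal X}\mathcal F_\beta(x)$ with $\mathcal F_\beta(x)=x^\top D x+\beta\|x\|_0$ and $\beta>0$. Let $S,P\subseteq\{1,\dots,N\}$ be disjoint (the current support set and the candidate set of a branch-and-bound node), let $j\in P$, $P^R=P\setminus\{j\}$, and let $S^R=S\cup P^R$ be nonempty. Let $ub^*$ be the objective value of the incumbent (the best feasible solution found so far), let $\epsilon>0$ be the optimality tolerance, and set $$lb^R=\xi(S^R)^\top D_{S^R}\,\xi(S^R)+\beta|S|.$$ If $lb^R+\beta\ge ub^*-\epsilon$, then every feasible portfolio $x\in\mathcal X$ such that $S\subsetneq\sigma(x)\subseteq S^R$ satisfies $$\mathcal F_\beta(x)=x^\top D x+\beta\|x\|_0\ge ub^*-\epsilon .$$ Consequently, every descendant support $\tilde S$ with $S\subsetneq\tilde S\subseteq S^R$ may be pruned, i.e. no feasible portfolio with support $\tilde S$ improves the incumbent value $ub^*$ by more than $\epsilon$.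
   Context: Data: $N\ge 1$; $D\in\mathbb R^{N\times N}$ is a symmetric positive definite matrix with diagonal entries $D_{ii}$; $\hat r\in\mathbb R^N$; $r_c,\bar r\in\mathbb R$; $\gamma>0$. Set $\mathfrak r=\hat r-r_c\mathbf 1\in\mathbb R^N$ (with entries $\mathfrak r[i]$, where $\mathbf 1$ is the all-ones vector) and $\bar{\mathfrak r}=\bar r-r_c$. Notation: $\|x\|_D=\sqrt{x^\top D x}$; $\sigma(x)=\{i:x[i]\ne0\}$ is the support of $x$ and $\|x\|_0=|\sigma(x)|$. The feasible set is $\mathcal X=\{x\in\mathbb R^N:\ \mathfrak r^\top x-\gamma\|x\|_D\ge\bar{\mathfrak r}\}$. Standing assumptions: (1) $\bar r>r_c$, i.e. $\bar{\mathfrak r}>0$; (2) $\min_{1\le i\le N}|\mathfrak r[i]|/\sqrt{D_{ii}}>\gamma$. For nonempty $\omega\subseteq\{1,\dots,N\}$, $D_\omega$ is the principal submatrix of $D$ indexed by $\omega$, $\mathfrak r_\omega$ is the subvector of $\mathfrak r$ indexed by $\omega$, and $H_\omega=\sqrt{\mathfrak r_\omega^\top (D_\omega)^{-1}\mathfrak r_\omega}$ (one has $H_\omega>\gamma$). The vector $$\xi(\omega)=\frac{\bar{\mathfrak r}}{H_\omega(H_\omega-\gamma)}(D_\omega)^{-1}\mathfrak r_\omega\in\mathbb R^{|\omega|}$$ is the unique solution of $\min\{u^\top D_\omega u:\ u\in\mathbb R^{|\omega|},\ \mathfrak r_\omega^\top u-\gamma\|u\|_{D_\omega}\ge\bar{\mathfrak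 r}\}$, where $\|u\|_{D_\omega}=\sqrt{u^\top D_\omega u}$. *)

theory Defs
  imports
    Complex_Main
    "Jordan_Normal_Form.Gauss_Jordan_Elimination"
    "Jordan_Normal_Form.DL_Submatrix"
begin

text \<open>
  Vectors in $R^N$ are elements of \<^term>\<open>carrier_vec N\<close>, so the assets $1, \dots, N$ are represented
  by the indices \<^term>\<open>{0..<N}\<close>.
\<close>

definition sym_pos_def :: "nat \<Rightarrow> real mat \<Rightarrow> bool" where
  "sym_pos_def N D \<longleftrightarrow>
     D \<in> carrier_mat N N \<and> transpose_mat D = D \<and>
     (\<forall>x \<in> carrier_vec N. x \<noteq> 0\<^sub>v N \<longrightarrow> 0 < x \<bullet> (D *\<^sub>v x))"

definition norm_wrt :: "real mat \<Rightarrow> real vec \<Rightarrow> real" where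
  "norm_wrt D x = sqrt (x \<bullet> (D *\<^sub>v x))"

definition supp :: "real vec \<Rightarrow> nat set" where
  "supp x = {i. i < dim_vec x \<and> x $ i \<noteq> 0}"

definition l0 :: "real vec \<Rightarrow> nat" where
  "l0 x = card (supp x)"

definition ones :: "nat \<Rightarrow> real vec" where
  "ones N = vec N (\<lambda>_. 1)"

definition feasible :: "nat \<Rightarrow> real mat \<Rightarrow> real vec \<Rightarrow> real \<Rightarrow> real \<Rightarrow> real vec set" where
  "feasible N D r \<gamma> \<rho> = {x \<in> carrier_vec N. r \<bullet> x - \<gamma> * norm_wrt D x \<ge> \<rho>}"

definition objective :: "real mat \<Rightarrow> real \<Rightarrow> real vec \<Rightarrow> real" where
  "objective D \<beta> x = x \<bullet> (D *\<^sub>v x) + \<beta> * real (l0 x)"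

definition principal_submatrix :: "real mat \<Rightarrow> nat set \<Rightarrow> real mat" where
  "principal_submatrix D \<omega> = submatrix D \<omega> \<omega>"

text \<open>
  \<^term>\<open>pick \<omega> k\<close> is the \<open>k\<close>-th smallest element of \<open>\<omega>\<close> (counting from 0); this is the enumeration
  underlying \<^const>\<open>submatrix\<close>, so the entries of a subvector and of a principal submatrix are
  listed in the same order.
\<close>

definition subvector :: "real vec \<Rightarrow> nat set \<Rightarrow> real vec" where
  "subvector v \<omega> = vec (card {i. i < dim_vec v \<and> i \<in> \<omega>}) (\<lambda>k. v $ pick \<omega> k)"

text \<open>
  \<^const>\<open>mat_inverse\<close> is option-valued; for positive definite \<open>D\<close> every principal submatrix is
  positive definite, hence invertible, and \<^const>\<open>the\<close> is applied to its actual inverse.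
\<close>

definition principal_inverse :: "real mat \<Rightarrow> nat set \<Rightarrow> real mat" where
  "principal_inverse D \<omega> = the (mat_inverse (principal_submatrix D \<omega>))"

definition H :: "real mat \<Rightarrow> real vec \<Rightarrow> nat set \<Rightarrow> real" where
  "H D r \<omega> = sqrt (subvector r \<omega> \<bullet> (principal_inverse D \<omega> *\<^sub>v subvector r \<omega>))"

definition xi :: "real mat \<Rightarrow> real vec \<Rightarrow> real \<Rightarrow> real \<Rightarrow> nat set \<Rightarrow> real vec" where
  "xi D r \<gamma> \<rho> \<omega> =
     (\<rho> / (H D r \<omega> * (H D r \<omega> - \<gamma>))) \<cdot>\<^sub>v (principal_inverse D \<omega> *\<^sub>v subvector r \<omega>)"

end

theory Submission
  imports Defs "Jordan_Normal_Form.Determinant"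
begin

text \<open>
  A portfolio whose support strictly contains \<open>S\<close> pays at least \<open>\<beta>\<close> more for its cardinality than
  \<open>\<beta> |S|\<close>, so it suffices that the risk term of \<open>lbR\<close> is a lower bound for \<open>x\<^sup>T D x\<close> over all
  feasible \<open>x\<close> supported in \<open>SR\<close>.

  For such an \<open>x\<close> nothing is lost by passing to the coordinates in \<open>\<omega> = SR\<close>: the return and the
  quadratic form of \<open>x\<close> are those of its subvector \<open>u\<close> with respect to the restricted data
  (\<open>scalar_prod_subvector\<close>, \<open>quadratic_form_subvector\<close>). Write \<open>A\<close> and \<open>b\<close> for the restricted matrix
  and vector, and \<open>c = A\<^sup>-\<^sup>1 b\<close>. Since \<open>b\<^sup>T u = c\<^sup>T A u\<close>, the Cauchy-Schwarz inequality of the inner product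
  defined by \<open>A\<close> gives \<open>b\<^sup>T u \<le> h \<parallel>u\<parallel>\<close> with \<open>h = \<parallel>c\<parallel> = H\<^sub>\<omega>\<close>, and feasibility implies
  \<open>\<rho> \<le> (h - \<gamma>) \<parallel>u\<parallel>\<close>. As \<open>\<rho> > 0\<close>, the mere existence of \<open>x\<close> yields \<open>h > \<gamma>\<close>, and
  \<open>\<parallel>u\<parallel>\<^sup>2 \<ge> \<rho>\<^sup>2 / (h - \<gamma>)\<^sup>2\<close>. The right-hand side is the energy of \<open>xi\<close>, a multiple of \<open>c\<close> scaled so
  that the estimate is attained.
\<close>

section \<open>Positive definite matrices\<close>

lemma sym_pos_def_nonneg:
  assumes A: "sym_pos_def n A" and v: "v \<in> carrier_vec n"
  shows "0 \<le> v \<bullet> (A *\<^sub>v v)"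
proof (cases "v = 0\<^sub>v n")
  case True
  then show ?thesis using A by (auto simp: sym_pos_def_def scalar_prod_def)
next
  case False
  then show ?thesis using A v by (force simp: sym_pos_def_def)
qed

text \<open>
  Cauchy-Schwarz for the inner product \<open>u\<^sup>T A v\<close>: the form is nonnegative at \<open>q u - p v\<close>, where
  \<open>q = v\<^sup>T A v\<close> and \<open>p = u\<^sup>T A v\<close>, and its value there is \<open>q (q u\<^sup>T A u - p\<^sup>2)\<close>.
\<close>

lemma sym_pos_def_Cauchy_Schwarz:
  assumes A: "sym_pos_def n A" and u: "u \<in> carrier_vec n" and v: "v \<in> carrier_vec n"
  shows "(u \<bullet> (A *\<^sub>v v))\<^sup>2 \<le> (u \<bullet> (A *\<^sub>v u)) * (v \<bullet> (A *\<^sub>v v))"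
proof (cases "v = 0\<^sub>v n")
  case True
  have "A *\<^sub>v 0\<^sub>v n = 0\<^sub>v n"
    using A by (auto simp: sym_pos_def_def intro!: eq_vecI)
  with True u show ?thesis by simp
next
  case False
  have Ac: "A \<in> carrier_mat n n" and At: "transpose_mat A = A"
    using A by (auto simp: sym_pos_def_def)
  have Auc: "A *\<^sub>v u \<in> carrier_vec n" and Avc: "A *\<^sub>v v \<in> carrier_vec n"
    using Ac u v by auto
  define q p e where "q = v \<bullet> (A *\<^sub>v v)" and "p = u \<bullet> (A *\<^sub>v v)" and "e = u \<bullet> (A *\<^sub>v u)"
  have q: "q > 0"
    using A v False by (auto simp: sym_pos_def_def q_def)
  have swap: "v \<bullet> (A *\<^sub>v u) = p"
    using transpose_vec_mult_scalar[OF Ac u v] At comm_scalar_prod[OF Avc u] by (simp add: p_def)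
  define w where "w = q \<cdot>\<^sub>v u - p \<cdot>\<^sub>v v"
  have w: "w \<in> carrier_vec n" using u v by (simp add: w_def)
  have Aw: "A *\<^sub>v w = q \<cdot>\<^sub>v (A *\<^sub>v u) - p \<cdot>\<^sub>v (A *\<^sub>v v)"
    using Ac u v by (simp add: w_def mult_minus_distrib_mat_vec[OF Ac] mult_mat_vec[OF Ac])
  have "w \<bullet> (A *\<^sub>v w) = q * (u \<bullet> (A *\<^sub>v w)) - p * (v \<bullet> (A *\<^sub>v w))"
    using u v w Ac unfolding w_def
    by (subst minus_scalar_prod_distrib[where n = n]) auto
  also have "u \<bullet> (A *\<^sub>v w) = q * e - p * p"
    using u Auc Avc unfolding Aw
    by (subst scalar_prod_minus_distrib[where n = n]) (auto simp: e_def p_def)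
  also have "v \<bullet> (A *\<^sub>v w) = q * p - p * q"
    using v Auc Avc swap unfolding Aw
    by (subst scalar_prod_minus_distrib[where n = n]) (auto simp: q_def)
  finally have form: "w \<bullet> (A *\<^sub>v w) = q * (q * e - p\<^sup>2)"
    by (simp add: power2_eq_square)
  have "w \<bullet> (A *\<^sub>v w) \<ge> 0"
    by (rule sym_pos_def_nonneg[OF A w])
  then have "q * e - p\<^sup>2 \<ge> 0"
    using q form by (simp add: zero_le_mult_iff)
  then show ?thesis by (simp add: p_def q_def e_def mult.commute)
qed

text \<open>
  The kernel of a positive definite matrix is trivial, so its determinant does not vanish and the
  option-valued inverse is defined.
\<close>

lemma sym_pos_def_mat_inverse:
  assumes A: "sym_pos_def n A"
  shows "A * the (mat_inverse A) = 1\<^sub>m n" and "the (mat_inverse A) \<in> carrier_mat n n"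
proof -
  have Ac: "A \<in> carrier_mat n n" using A by (simp add: sym_pos_def_def)
  have "det A \<noteq> 0"
  proof
    assume "det A = 0"
    then obtain v where v: "v \<in> carrier_vec n" "v \<noteq> 0\<^sub>v n" "A *\<^sub>v v = 0\<^sub>v n"
      using det_0_iff_vec_prod_zero_field[OF Ac] by blast
    then have "0 < v \<bullet> (A *\<^sub>v v)" using A unfolding sym_pos_def_def by blast
    with v show False by simp
  qed
  then have "mat_inverse A \<noteq> None"
    using det_non_zero_imp_unit[OF Ac, where b = "()"] mat_inverse(1)[OF Ac, where b = "()"] by blast
  then obtain B where "mat_inverse A = Some B" by auto
  with mat_inverse(2)[OF Ac this]
  show "A * the (mat_inverse A) = 1\<^sub>m n" and "the (mat_inverse A) \<in> carrier_mat n n" by auto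
qed

section \<open>Restriction to a set of coordinates\<close>

lemma bij_betw_pick:
  assumes "finite \<omega>"
  shows "bij_betw (pick \<omega>) {0..<card \<omega>} \<omega>"
proof (rule bij_betw_byWitness[where f' = "\<lambda>i. card {a \<in> \<omega>. a < i}"])
  show "\<forall>k\<in>{0..<card \<omega>}. card {a \<in> \<omega>. a < pick \<omega> k} = k"
    by (auto intro: card_pick)
  show "\<forall>i\<in>\<omega>. pick \<omega> (card {a \<in> \<omega>. a < i}) = i"
    by (auto intro: pick_card_in_set)
  show "pick \<omega> ` {0..<card \<omega>} \<subseteq> \<omega>"
    by (auto intro: pick_in_set_le)
  show "(\<lambda>i. card {a \<in> \<omega>. a < i}) ` \<omega> \<subseteq> {0..<card \<omega>}"
    using assms by (auto intro!: psubset_card_mono)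
qed

lemma restricted_index_set:
  assumes "\<omega> \<subseteq> {0..<N}"
  shows "{i. i < N \<and> i \<in> \<omega>} = \<omega>"
  using assms by auto

lemma subvector_carrier:
  assumes "x \<in> carrier_vec N" and "\<omega> \<subseteq> {0..<N}"
  shows "subvector x \<omega> \<in> carrier_vec (card \<omega>)"
  using assms restricted_index_set[OF assms(2)] by (simp add: subvector_def)

lemma subvector_index:
  assumes "x \<in> carrier_vec N" and "\<omega> \<subseteq> {0..<N}" and "k < card \<omega>"
  shows "subvector x \<omega> $ k = x $ pick \<omega> k"
  using assms restricted_index_set[OF assms(2)] by (simp add: subvector_def)

lemma scalar_prod_subvector:
  assumes y: "y \<in> carrier_vec N" and x: "x \<in> carrier_vec N"
    and \<omega>: "\<omega> \<subseteq> {0..<N}" and x_supp: "supp x \<subseteq> \<omega>"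
  shows "y \<bullet> x = subvector y \<omega> \<bullet> subvector x \<omega>"
proof -
  have fin: "finite \<omega>" using \<omega> by (rule finite_subset) simp
  have "y \<bullet> x = (\<Sum>i\<in>{0..<N}. y $ i * x $ i)"
    using x by (simp add: scalar_prod_def)
  also have "\<dots> = (\<Sum>i\<in>\<omega>. y $ i * x $ i)"
    using \<omega> x x_supp by (intro sum.mono_neutral_right) (auto simp: supp_def)
  also have "\<dots> = (\<Sum>k\<in>{0..<card \<omega>}. y $ pick \<omega> k * x $ pick \<omega> k)"
    using sum.reindex_bij_betw[OF bij_betw_pick[OF fin]] by (rule sym)
  also have "\<dots> = subvector y \<omega> \<bullet> subvector x \<omega>"
    using subvector_carrier[OF x \<omega>] x y \<omega>
    by (simp add: scalar_prod_def subvector_index[OF x \<omega>] subvector_index[OF y \<omega>])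
  finally show ?thesis .
qed

lemma principal_submatrix_carrier:
  assumes "D \<in> carrier_mat N N" and "\<omega> \<subseteq> {0..<N}"
  shows "principal_submatrix D \<omega> \<in> carrier_mat (card \<omega>) (card \<omega>)"
  using assms restricted_index_set[OF assms(2)]
  by (simp add: principal_submatrix_def submatrix_def)

lemma principal_submatrix_index:
  assumes "D \<in> carrier_mat N N" and "\<omega> \<subseteq> {0..<N}" and "i < card \<omega>" and "k < card \<omega>"
  shows "principal_submatrix D \<omega> $$ (i, k) = D $$ (pick \<omega> i, pick \<omega> k)"
  using assms restricted_index_set[OF assms(2)]
  by (simp add: principal_submatrix_def submatrix_def)

lemma principal_submatrix_mult_subvector:
  assumes D: "D \<in> carrier_mat N N" and x: "x \<in> carrier_vec N"
    and \<omega>: "\<omega> \<subseteq> {0..<N}" and x_supp: "supp x \<subseteq> \<omega>"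
  shows "principal_submatrix D \<omega> *\<^sub>v subvector x \<omega> = subvector (D *\<^sub>v x) \<omega>"
proof (rule eq_vecI)
  have Dx: "D *\<^sub>v x \<in> carrier_vec N" using D x by simp
  show "dim_vec (principal_submatrix D \<omega> *\<^sub>v subvector x \<omega>) = dim_vec (subvector (D *\<^sub>v x) \<omega>)"
    using principal_submatrix_carrier[OF D \<omega>] subvector_carrier[OF Dx \<omega>] by simp
  fix k assume "k < dim_vec (subvector (D *\<^sub>v x) \<omega>)"
  then have k: "k < card \<omega>" using subvector_carrier[OF Dx \<omega>] by simp
  have pk: "pick \<omega> k < N" using pick_in_set_le[OF k] \<omega> by auto
  have row: "row D (pick \<omega> k) \<in> carrier_vec N" using D by auto
  have "row (principal_submatrix D \<omega>) k = subvector (row D (pick \<omega> k)) \<omega>"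
  proof (rule eq_vecI)
    show "dim_vec (row (principal_submatrix D \<omega>) k) = dim_vec (subvector (row D (pick \<omega> k)) \<omega>)"
      using principal_submatrix_carrier[OF D \<omega>] subvector_carrier[OF row \<omega>] by simp
    fix l assume "l < dim_vec (subvector (row D (pick \<omega> k)) \<omega>)"
    then have l: "l < card \<omega>" using subvector_carrier[OF row \<omega>] by simp
    have "pick \<omega> l < N" using pick_in_set_le[OF l] \<omega> by auto
    then show "row (principal_submatrix D \<omega>) k $ l = subvector (row D (pick \<omega> k)) \<omega> $ l"
      using D k l pk principal_submatrix_carrier[OF D \<omega>]
      by (simp add: subvector_index[OF row \<omega>] principal_submatrix_index[OF D \<omega>])
  qed
  then show "(principal_submatrix D \<omega> *\<^sub>v subvector x \<omega>) $ k = subvector (D *\<^sub>v x) \<omega> $ k"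
    using k pk D principal_submatrix_carrier[OF D \<omega>] scalar_prod_subvector[OF row x \<omega> x_supp]
    by (simp add: subvector_index[OF Dx \<omega>])
qed

lemma quadratic_form_subvector:
  assumes D: "D \<in> carrier_mat N N" and x: "x \<in> carrier_vec N"
    and \<omega>: "\<omega> \<subseteq> {0..<N}" and x_supp: "supp x \<subseteq> \<omega>"
  shows "subvector x \<omega> \<bullet> (principal_submatrix D \<omega> *\<^sub>v subvector x \<omega>) = x \<bullet> (D *\<^sub>v x)"
proof -
  have Dx: "D *\<^sub>v x \<in> carrier_vec N" using D x by simp
  have "x \<bullet> (D *\<^sub>v x) = (D *\<^sub>v x) \<bullet> x"
    by (rule comm_scalar_prod[OF x Dx])
  also have "\<dots> = subvector (D *\<^sub>v x) \<omega> \<bullet> subvector x \<omega>"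
    by (rule scalar_prod_subvector[OF Dx x \<omega> x_supp])
  also have "\<dots> = subvector x \<omega> \<bullet> subvector (D *\<^sub>v x) \<omega>"
    by (rule comm_scalar_prod[OF subvector_carrier[OF Dx \<omega>] subvector_carrier[OF x \<omega>]])
  finally show ?thesis
    by (simp add: principal_submatrix_mult_subvector[OF D x \<omega> x_supp])
qed

lemma subvector_surj:
  assumes u: "u \<in> carrier_vec (card \<omega>)" and \<omega>: "\<omega> \<subseteq> {0..<N}"
  obtains x where "x \<in> carrier_vec N" and "supp x \<subseteq> \<omega>" and "subvector x \<omega> = u"
proof
  define x where "x = vec N (\<lambda>i. if i \<in> \<omega> then u $ card {a \<in> \<omega>. a < i} else 0)"
  show x: "x \<in> carrier_vec N" by (simp add: x_def)
  show "supp x \<subseteq> \<omega>" by (auto simp: x_def supp_def split: if_splits)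
  show "subvector x \<omega> = u"
  proof (rule eq_vecI)
    show "dim_vec (subvector x \<omega>) = dim_vec u" using u subvector_carrier[OF x \<omega>] by simp
    fix k assume "k < dim_vec u"
    then have k: "k < card \<omega>" using u by simp
    then show "subvector x \<omega> $ k = u $ k"
      using pick_in_set_le[OF k] \<omega> card_pick[of k \<omega>]
      by (subst subvector_index[OF x \<omega> k]) (auto simp: x_def)
  qed
qed

text \<open>
  Positivity is inherited because every vector on the coordinates \<open>\<omega>\<close> is the subvector of its
  extension by zero, which has the same quadratic form.
\<close>

lemma sym_pos_def_principal_submatrix:
  assumes D: "sym_pos_def N D" and \<omega>: "\<omega> \<subseteq> {0..<N}"
  shows "sym_pos_def (card \<omega>) (principal_submatrix D \<omega>)"
  unfolding sym_pos_def_def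
proof (intro conjI ballI impI)
  have Dc: "D \<in> carrier_mat N N" and Dt: "transpose_mat D = D"
    using D by (auto simp: sym_pos_def_def)
  show Ac: "principal_submatrix D \<omega> \<in> carrier_mat (card \<omega>) (card \<omega>)"
    by (rule principal_submatrix_carrier[OF Dc \<omega>])
  have D_swap: "D $$ (l, k) = D $$ (k, l)" if "k < N" "l < N" for k l
    using index_transpose_mat(1)[of k D l] Dc Dt that by simp
  show "transpose_mat (principal_submatrix D \<omega>) = principal_submatrix D \<omega>"
  proof (rule eq_matI)
    fix k l
    assume "k < dim_row (principal_submatrix D \<omega>)" "l < dim_col (principal_submatrix D \<omega>)"
    then have kl: "k < card \<omega>" "l < card \<omega>" using Ac by auto
    have "pick \<omega> k < N" "pick \<omega> l < N" using pick_in_set_le kl \<omega> by fastforce+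
    then show "transpose_mat (principal_submatrix D \<omega>) $$ (k, l) = principal_submatrix D \<omega> $$ (k, l)"
      using kl Ac D_swap by (simp add: principal_submatrix_index[OF Dc \<omega>])
  qed (use Ac in auto)
  fix u :: "real vec"
  assume u: "u \<in> carrier_vec (card \<omega>)" "u \<noteq> 0\<^sub>v (card \<omega>)"
  obtain x where x: "x \<in> carrier_vec N" "supp x \<subseteq> \<omega>" "subvector x \<omega> = u"
    using subvector_surj[OF u(1) \<omega>] by blast
  have "x \<noteq> 0\<^sub>v N"
  proof
    assume zero: "x = 0\<^sub>v N"
    have "u = 0\<^sub>v (card \<omega>)"
    proof (rule eq_vecI)
      fix k assume "k < dim_vec (0\<^sub>v (card \<omega>) :: real vec)"
      then have k: "k < card \<omega>" by simp
      moreover have "pick \<omega> k < N" using pick_in_set_le[OF k] \<omega> by auto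
      ultimately show "u $ k = 0\<^sub>v (card \<omega>) $ k"
        using subvector_index[OF x(1) \<omega> k] x(3) zero by simp
    qed (use u in simp)
    with u show False by simp
  qed
  then have "0 < x \<bullet> (D *\<^sub>v x)" using D x(1) by (simp add: sym_pos_def_def)
  then show "0 < u \<bullet> (principal_submatrix D \<omega> *\<^sub>v u)"
    using quadratic_form_subvector[OF Dc x(1) \<omega> x(2)] x(3) by simp
qed

section \<open>The optimal risk on a set of coordinates\<close>

text \<open>
  Both parts rest on writing the restricted return vector \<open>b\<close> as \<open>A c\<close> with \<open>c = A\<^sup>-\<^sup>1 b\<close>: then \<open>H\<^sub>\<omega>\<close> is the norm of \<open>c\<close>, which gives
  the energy of a multiple of \<open>c\<close>, and the return \<open>b\<^sup>T u\<close> is the inner product of \<open>u\<close> and \<open>c\<close>, to which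
  Cauchy-Schwarz applies.
\<close>

lemma restricted_return_bounds:
  fixes \<omega> :: "nat set" and D :: "real mat" and r :: "real vec"
  assumes D: "sym_pos_def N D" and r: "r \<in> carrier_vec N" and \<omega>: "\<omega> \<subseteq> {0..<N}"
  defines "A \<equiv> principal_submatrix D \<omega>"
  shows return_le_H_norm:
      "u \<in> carrier_vec (card \<omega>) \<Longrightarrow> subvector r \<omega> \<bullet> u \<le> H D r \<omega> * norm_wrt A u"
    and xi_energy:
      "H D r \<omega> \<noteq> 0 \<Longrightarrow> xi D r \<gamma> \<rho> \<omega> \<bullet> (A *\<^sub>v xi D r \<gamma> \<rho> \<omega>) = (\<rho> / (H D r \<omega> - \<gamma>))\<^sup>2"
proof -
  define n b c where "n = card \<omega>" and "b = subvector r \<omega>" and "c = principal_inverse D \<omega> *\<^sub>v b"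
  have spd: "sym_pos_def n A"
    unfolding A_def n_def by (rule sym_pos_def_principal_submatrix[OF D \<omega>])
  then have Ac: "A \<in> carrier_mat n n" by (simp add: sym_pos_def_def)
  have b: "b \<in> carrier_vec n" unfolding b_def n_def by (rule subvector_carrier[OF r \<omega>])
  have inv: "A * principal_inverse D \<omega> = 1\<^sub>m n" "principal_inverse D \<omega> \<in> carrier_mat n n"
    using sym_pos_def_mat_inverse[OF spd] by (simp_all add: principal_inverse_def A_def)
  have c: "c \<in> carrier_vec n" using inv b by (simp add: c_def)
  have b_eq: "A *\<^sub>v c = b"
    using assoc_mult_mat_vec[OF Ac inv(2) b] inv(1) b by (simp add: c_def)
  have c_nonneg: "c \<bullet> (A *\<^sub>v c) \<ge> 0"
    by (rule sym_pos_def_nonneg[OF spd c])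
  have H_eq: "H D r \<omega> = sqrt (c \<bullet> (A *\<^sub>v c))"
    using comm_scalar_prod[OF b c] unfolding b_eq by (simp add: H_def c_def b_def)
  show "subvector r \<omega> \<bullet> u \<le> H D r \<omega> * norm_wrt A u" if "u \<in> carrier_vec (card \<omega>)"
  proof -
    have u: "u \<in> carrier_vec n" using that by (simp add: n_def)
    have "subvector r \<omega> \<bullet> u = u \<bullet> (A *\<^sub>v c)"
      using comm_scalar_prod[OF b u] by (simp add: b_eq b_def)
    also have "\<dots> \<le> sqrt ((u \<bullet> (A *\<^sub>v u)) * (c \<bullet> (A *\<^sub>v c)))"
      by (rule real_le_rsqrt[OF sym_pos_def_Cauchy_Schwarz[OF spd u c]])
    also have "\<dots> = H D r \<omega> * norm_wrt A u"
      by (simp add: H_eq norm_wrt_def real_sqrt_mult mult.commute)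
    finally show ?thesis .
  qed
  show "xi D r \<gamma> \<rho> \<omega> \<bullet> (A *\<^sub>v xi D r \<gamma> \<rho> \<omega>) = (\<rho> / (H D r \<omega> - \<gamma>))\<^sup>2" if "H D r \<omega> \<noteq> 0"
  proof -
    define h s where "h = H D r \<omega>" and "s = \<rho> / (h * (h - \<gamma>))"
    have "xi D r \<gamma> \<rho> \<omega> = s \<cdot>\<^sub>v c" by (simp add: xi_def s_def h_def c_def b_def)
    then have "xi D r \<gamma> \<rho> \<omega> \<bullet> (A *\<^sub>v xi D r \<gamma> \<rho> \<omega>) = s * (s * (c \<bullet> (A *\<^sub>v c)))"
      using Ac c by (simp add: mult_mat_vec[OF Ac c])
    also have "\<dots> = (s * h)\<^sup>2"
      using c_nonneg by (simp add: h_def H_eq power2_eq_square)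
    also have "s * h = \<rho> / (h - \<gamma>)" using that by (simp add: s_def h_def)
    finally show ?thesis by (simp add: h_def)
  qed
qed

text \<open>
  This is the half of the optimality of \<open>xi\<close> that bounding needs: no feasible portfolio supported in
  \<open>\<omega>\<close> has less risk. Feasibility implies \<open>\<rho> \<le> (H\<^sub>\<omega> - \<gamma>) \<parallel>x\<parallel>\<close>, and \<open>\<rho> > 0\<close> forces both factors to be
  positive, so one may divide and square.
\<close>

lemma xi_energy_le_feasible:
  assumes D: "sym_pos_def N D" and r: "r \<in> carrier_vec N" and \<omega>: "\<omega> \<subseteq> {0..<N}"
    and \<gamma>: "\<gamma> \<ge> 0" and \<rho>: "\<rho> > 0"
    and x: "x \<in> feasible N D r \<gamma> \<rho>" and x_supp: "supp x \<subseteq> \<omega>"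
  shows "xi D r \<gamma> \<rho> \<omega> \<bullet> (principal_submatrix D \<omega> *\<^sub>v xi D r \<gamma> \<rho> \<omega>) \<le> x \<bullet> (D *\<^sub>v x)"
proof -
  define h t where "h = H D r \<omega>" and "t = norm_wrt D x"
  have Dc: "D \<in> carrier_mat N N" using D by (simp add: sym_pos_def_def)
  have xc: "x \<in> carrier_vec N" and feas: "\<rho> \<le> r \<bullet> x - \<gamma> * t"
    using x by (auto simp: feasible_def t_def)
  have form_nonneg: "x \<bullet> (D *\<^sub>v x) \<ge> 0"
    by (rule sym_pos_def_nonneg[OF D xc])
  then have t: "t \<ge> 0" by (simp add: t_def norm_wrt_def)
  have "r \<bullet> x \<le> h * t"
    using return_le_H_norm[OF D r \<omega> subvector_carrier[OF xc \<omega>]]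
      scalar_prod_subvector[OF r xc \<omega> x_supp] quadratic_form_subvector[OF Dc xc \<omega> x_supp]
    by (simp add: h_def t_def norm_wrt_def)
  with feas have le: "\<rho> \<le> (h - \<gamma>) * t" by (simp add: algebra_simps)
  with \<rho> have "0 < (h - \<gamma>) * t" by simp
  with t have gap: "h - \<gamma> > 0" by (auto simp: zero_less_mult_iff)
  then have "H D r \<omega> \<noteq> 0" using \<gamma> by (simp add: h_def)
  then have "xi D r \<gamma> \<rho> \<omega> \<bullet> (principal_submatrix D \<omega> *\<^sub>v xi D r \<gamma> \<rho> \<omega>) = (\<rho> / (h - \<gamma>))\<^sup>2"
    using xi_energy[OF D r \<omega>] by (simp add: h_def)
  also have "\<dots> \<le> t\<^sup>2"
    using le gap \<rho> by (intro power_mono) (simp_all add: divide_le_eq mult.commute)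
  also have "t\<^sup>2 = x \<bullet> (D *\<^sub>v x)"
    using form_nonneg by (simp add: t_def norm_wrt_def)
  finally show ?thesis .
qed

section \<open>Pruning\<close>

theorem proposition11:
  fixes N :: nat
    and D :: "real mat"
    and rhat r :: "real vec"
    and rc rbar \<rho> \<gamma> \<beta> \<epsilon> ub lbR :: real
    and S P PR SR :: "nat set"
    and j :: nat
    and found :: "real vec set"
    and xinc :: "real vec"
  assumes N: "N \<ge> 1"
    and D: "sym_pos_def N D"
    and rhat: "rhat \<in> carrier_vec N"
    and \<gamma>: "\<gamma> > 0"
    and r: "r = rhat - rc \<cdot>\<^sub>v ones N"
    and \<rho>: "\<rho> = rbar - rc"
    and standing1: "rbar > rc"
    and standing2: "Min ((\<lambda>i. \<bar>r $ i\<bar> / sqrt (D $$ (i, i))) ` {0..<N}) > \<gamma>"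
    and \<beta>: "\<beta> > 0"
    and S: "S \<subseteq> {0..<N}"
    and P: "P \<subseteq> {0..<N}"
    and disj: "S \<inter> P = {}"
    and j: "j \<in> P"
    and PR: "PR = P - {j}"
    and SR: "SR = S \<union> PR"
    and SR_nonempty: "SR \<noteq> {}"
    and found: "found \<subseteq> feasible N D r \<gamma> \<rho>"
    and incumbent: "is_arg_min (objective D \<beta>) (\<lambda>x. x \<in> found) xinc"
    and ub: "ub = objective D \<beta> xinc"
    and \<epsilon>: "\<epsilon> > 0"
    and lbR: "lbR = xi D r \<gamma> \<rho> SR \<bullet> (principal_submatrix D SR *\<^sub>v xi D r \<gamma> \<rho> SR)
                    + \<beta> * real (card S)"
    and prune: "lbR + \<beta> \<ge> ub - \<epsilon>"
  shows "(\<forall>x \<in> feasible N D r \<gamma> \<rho>. S \<subset> supp x \<and> supp x \<subseteq> SR \<longrightarrow>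
            objective D \<beta> x \<ge> ub - \<epsilon>) \<and>
         (\<forall>St. S \<subset> St \<and> St \<subseteq> SR \<longrightarrow>
            \<not> (\<exists>x \<in> feasible N D r \<gamma> \<rho>. supp x = St \<and> objective D \<beta> x < ub - \<epsilon>))"
proof -
  have rc: "r \<in> carrier_vec N" using rhat by (simp add: r ones_def)
  have SR_sub: "SR \<subseteq> {0..<N}" using S P by (auto simp: SR PR)
  have bound: "objective D \<beta> x \<ge> ub - \<epsilon>"
    if x: "x \<in> feasible N D r \<gamma> \<rho>" and sub: "S \<subset> supp x" and sup: "supp x \<subseteq> SR" for x
  proof -
    have "finite (supp x)" by (simp add: supp_def)
    then have "card S < card (supp x)" using sub by (rule psubset_card_mono)
    then have "real (card S) + 1 \<le> real (l0 x)" by (simp add: l0_def)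
    then have "\<beta> * (real (card S) + 1) \<le> \<beta> * real (l0 x)"
      using \<beta> by (intro mult_left_mono) auto
    moreover have "xi D r \<gamma> \<rho> SR \<bullet> (principal_submatrix D SR *\<^sub>v xi D r \<gamma> \<rho> SR) \<le> x \<bullet> (D *\<^sub>v x)"
      using \<gamma> standing1 by (intro xi_energy_le_feasible[OF D rc SR_sub _ _ x sup]) (auto simp: \<rho>)
    ultimately have "lbR + \<beta> \<le> objective D \<beta> x"
      by (simp add: lbR objective_def algebra_simps)
    with prune show ?thesis by simp
  qed
  show ?thesis
  proof (intro conjI ballI allI impI notI)
    fix x assume "x \<in> feasible N D r \<gamma> \<rho>" and "S \<subset> supp x \<and> supp x \<subseteq> SR"
    then show "objective D \<beta> x \<ge> ub - \<epsilon>" using bound by blast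
  next
    fix St
    assume St: "S \<subset> St \<and> St \<subseteq> SR"
      and "\<exists>x \<in> feasible N D r \<gamma> \<rho>. supp x = St \<and> objective D \<beta> x < ub - \<epsilon>"
    then obtain x where "x \<in> feasible N D r \<gamma> \<rho>" "supp x = St" "objective D \<beta> x < ub - \<epsilon>"
      by blast
    with bound[of x] St show False by simp
  qed
qed

end
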